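(* Assume $x^{\circ} \in X$ is partially randomized with respect to $j_1, \dots, j_p \in J$, where $p\in\{2, \dots, n-1\}$. Then $x^{\circ} \in X_E$ if and only if $Y(j_1, \dots, j_p) \subseteq X_E$.
   Context: Let $k \ge 2$ and $n \ge 2$ be integers, $c_1,\dots,c_k \in \mathbb{R}^n$, and $J=\{1,\dots,n\}$. Let $X = \{x\in\mathbb{R}^n : \sum_{j=1}^n x_j = 1,\ x_j \ge 0 \text{ for all } j\in J\}$. A point $x^{\circ}\in X$ is an efficient solution (of the problem of simultaneously maximizing $c_1^Tx,\dots,c_k^Tx$ over $X$) if there is no $x\in X$ with $c_i^Tx \ge c_i^Tx^{\circ}$ for all $i=1,\dots,k$ and at least one of these inequalities strict. $X_E$ denotes the set of all efficient solutions. A point $x\in X$ is partially randomized with respect to distinct indices $j_1,\dots,j_p\in J$, where $2\le p\le n-1$, if $x_{j_i}>0$ for all $i=1,\dots,p$ and $\sum_{i=1}^p x_{j_i}=1$ (so all other components are $0$; no such points exist when $n=2$). With $\bm{e}_j$ the $j$th standard basis vector of $\mathbb{R}^n$, $Y(j_1,\dots,j_p)=\{x_{j_1}\bm{e}_{j_1}+\dots+x_{j_p}\bm{e}_{j_p} : \sum_{i=1}^p x_{j_i}=1,\ x_{j_i}>0 \text{ for all } i=1,\dots,p\}$. *)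

theory Defs
  imports "HOL-Analysis.Analysis"
begin

text \<open>The index set \<open>J\<close> of the coordinates is the finite type \<open>'n\<close>, so \<open>n = CARD('n)\<close>.\<close>

definition strategy_set :: "(real ^ 'n) set" where
  "strategy_set = {x. (\<Sum>j\<in>UNIV. x $ j) = 1 \<and> (\<forall>j. x $ j \<ge> 0)}"

definition efficient_set :: "nat \<Rightarrow> (nat \<Rightarrow> real ^ 'n) \<Rightarrow> (real ^ 'n) set" where
  "efficient_set k c =
    {x0 \<in> strategy_set.
      \<not> (\<exists>x\<in>strategy_set.
          (\<forall>i\<in>{1..k}. c i \<bullet> x \<ge> c i \<bullet> x0) \<and>
          (\<exists>i\<in>{1..k}. c i \<bullet> x > c i \<bullet> x0))}"

text \<open>The indices \<open>j\<^sub>1, \<dots>, j\<^sub>p\<close> are the values of a map \<open>j\<close> on \<open>{1..p}\<close>;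
  its values elsewhere play no role.\<close>

definition partially_randomized :: "nat \<Rightarrow> (nat \<Rightarrow> 'n) \<Rightarrow> real ^ 'n \<Rightarrow> bool" where
  "partially_randomized p j x \<longleftrightarrow>
    x \<in> strategy_set \<and> p \<in> {2..CARD('n) - 1} \<and> inj_on j {1..p} \<and>
    (\<forall>i\<in>{1..p}. x $ j i > 0) \<and> (\<Sum>i = 1..p. x $ j i) = 1"

definition face_interior :: "nat \<Rightarrow> (nat \<Rightarrow> 'n) \<Rightarrow> (real ^ 'n) set" where
  "face_interior p j =
    {(\<Sum>i = 1..p. (x $ j i) *\<^sub>R axis (j i) 1) | x :: real ^ 'n.
      (\<Sum>i = 1..p. x $ j i) = 1 \<and> (\<forall>i\<in>{1..p}. x $ j i > 0)}"

end

theory Submission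
  imports Defs
begin

text \<open>
  Efficiency of a point of the simplex depends only on its support. Suppose \<open>z\<close> dominates \<open>y\<close>.
  The direction \<open>z - y\<close> improves the objectives from every starting point, because the
  objectives are linear. From a point \<open>x\<close> of the simplex one can follow it a little way without
  leaving the simplex as soon as the coordinates that may decrease, which lie in the support of
  \<open>y\<close>, are positive at \<open>x\<close>. Hence an efficient \<open>x\<close> forces every \<open>y\<close> whose support lies in that
  of \<open>x\<close> to be efficient (\<open>efficient_support_mono\<close>).

  The set \<open>face_interior p j\<close> consists of points of the simplex with support
  \<open>j ` {1..p}\<close>, and a partially randomized point is one of them. One direction of the equivalence
  is therefore the statement about supports, and the other is membership.
\<close>

text \<open>The left-hand side of the bound is the mass that a step of length \<open>t\<close> along \<open>z - y\<close> can at
  most remove from a coordinate, so this supplies the step length.\<close>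

lemma positive_multiple_below:
  fixes x y :: "real ^ 'n"
  assumes x: "x \<in> strategy_set" and y: "y \<in> strategy_set"
    and supp: "\<And>l. x $ l = 0 \<Longrightarrow> y $ l = 0"
  obtains t where "t > 0" "\<And>l. t * y $ l \<le> x $ l"
proof
  define f where "f l = (if x $ l = 0 then 1 else x $ l)" for l
  have x_nonneg: "x $ l \<ge> 0" and y_nonneg: "y $ l \<ge> 0" for l
    using x y by (auto simp: strategy_set_def)
  have y_le_1: "y $ l \<le> 1" for l
    using y member_le_sum[of l UNIV "\<lambda>l. y $ l"] by (simp add: strategy_set_def)
  have f_pos: "f l > 0" for l
    using x_nonneg[of l] by (simp add: f_def)
  then show t_pos: "Min (range f) > 0"
    by simp
  show "Min (range f) * y $ l \<le> x $ l" for l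
  proof (cases "x $ l = 0")
    case True
    then show ?thesis by (simp add: supp)
  next
    case False
    have "Min (range f) * y $ l \<le> Min (range f)"
      using mult_left_le[OF y_le_1 less_imp_le[OF t_pos]] .
    also have "\<dots> \<le> f l" by simp
    finally show ?thesis using False by (simp add: f_def)
  qed
qed

text \<open>If \<open>z\<close> dominates \<open>y\<close>, then \<open>x + t (z - y)\<close> dominates \<open>x\<close> for every \<open>t > 0\<close>; for small \<open>t\<close>
  it is still in the simplex.\<close>

lemma efficient_support_mono:
  fixes x y :: "real ^ 'n"
  assumes x_eff: "x \<in> efficient_set k c" and y: "y \<in> strategy_set"
    and supp: "\<And>l. x $ l = 0 \<Longrightarrow> y $ l = 0"
  shows "y \<in> efficient_set k c"
proof (rule ccontr)
  assume "y \<notin> efficient_set k c"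
  then obtain z i where z: "z \<in> strategy_set"
    and weak: "\<And>i. i \<in> {1..k} \<Longrightarrow> c i \<bullet> z \<ge> c i \<bullet> y"
    and i: "i \<in> {1..k}" and strict: "c i \<bullet> z > c i \<bullet> y"
    using y unfolding efficient_set_def by blast
  have x: "x \<in> strategy_set"
    using x_eff by (simp add: efficient_set_def)
  obtain t where t: "t > 0" and below: "\<And>l. t * y $ l \<le> x $ l"
    using positive_multiple_below[OF x y supp] by blast
  define w where "w = x + t *\<^sub>R (z - y)"
  have "w $ l \<ge> 0" for l
  proof -
    have "t * z $ l \<ge> 0"
      using z t by (simp add: strategy_set_def)
    with below[of l] show ?thesis
      by (simp add: w_def algebra_simps)
  qed
  moreover have "(\<Sum>l\<in>UNIV. w $ l) = 1"
    using x y z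
    by (simp add: w_def strategy_set_def sum.distrib sum_subtractf flip: sum_distrib_left)
  ultimately have "w \<in> strategy_set"
    by (simp add: strategy_set_def)
  moreover have gain: "c i \<bullet> w = c i \<bullet> x + t * (c i \<bullet> z - c i \<bullet> y)" for i
    by (simp add: w_def inner_add_right inner_diff_right)
  have "\<forall>i\<in>{1..k}. c i \<bullet> w \<ge> c i \<bullet> x"
    using weak t by (simp add: gain)
  moreover have "c i \<bullet> w > c i \<bullet> x"
    using strict t by (simp add: gain)
  ultimately show False
    using x_eff i unfolding efficient_set_def by blast
qed

lemma sum_axis_nth:
  fixes x :: "real ^ 'n"
  assumes "inj_on j {1..p}"
  shows "(\<Sum>i = 1..p. (x $ j i) *\<^sub>R axis (j i) 1) $ l = (if l \<in> j ` {1..p} then x $ l else 0)"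
proof -
  have "(\<Sum>i = 1..p. (x $ j i) *\<^sub>R axis (j i) (1::real)) $ l
      = (\<Sum>m\<in>j ` {1..p}. if m = l then x $ m else 0)"
    unfolding sum.reindex[OF assms] by (auto simp: axis_def intro!: sum.cong)
  then show ?thesis by simp
qed

lemma face_interior_in_strategy_set:
  fixes y :: "real ^ 'n"
  assumes inj: "inj_on j {1..p}" and y: "y \<in> face_interior p j"
  shows "y \<in> strategy_set" and "\<And>l. l \<notin> j ` {1..p} \<Longrightarrow> y $ l = 0"
proof -
  obtain x :: "real ^ 'n" where y_eq: "y = (\<Sum>i = 1..p. (x $ j i) *\<^sub>R axis (j i) 1)"
    and sum1: "(\<Sum>i = 1..p. x $ j i) = 1" and pos: "\<forall>i\<in>{1..p}. x $ j i > 0"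
    using y unfolding face_interior_def by blast
  have nth: "y $ l = (if l \<in> j ` {1..p} then x $ l else 0)" for l
    unfolding y_eq by (rule sum_axis_nth[OF inj])
  have "(\<Sum>l\<in>UNIV. y $ l) = (\<Sum>l\<in>j ` {1..p}. x $ l)"
    by (simp add: nth sum.If_cases)
  also have "\<dots> = 1"
    using sum1 unfolding sum.reindex[OF inj] by simp
  finally show "y \<in> strategy_set"
    using pos by (auto simp: strategy_set_def nth less_imp_le)
  show "y $ l = 0" if "l \<notin> j ` {1..p}" for l
    using that by (simp add: nth)
qed

text \<open>The chosen coordinates already carry the whole mass \<open>1\<close>, so the other coordinates, being
  nonnegative, vanish.\<close>

lemma partially_randomized_in_face_interior:
  fixes x :: "real ^ 'n"
  assumes "partially_randomized p j x"
  shows "x \<in> face_interior p j"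
proof -
  have x: "x \<in> strategy_set" and inj: "inj_on j {1..p}"
    and pos: "\<forall>i\<in>{1..p}. x $ j i > 0" and sum1: "(\<Sum>i = 1..p. x $ j i) = 1"
    using assms by (auto simp: partially_randomized_def)
  have "(\<Sum>l\<in>UNIV. x $ l) = (\<Sum>l\<in>- j ` {1..p}. x $ l) + (\<Sum>l\<in>j ` {1..p}. x $ l)"
    by (simp add: Compl_eq_Diff_UNIV flip: sum.subset_diff)
  then have "(\<Sum>l\<in>- j ` {1..p}. x $ l) = 0"
    using x sum1 unfolding sum.reindex[OF inj] by (simp add: strategy_set_def)
  then have zero: "x $ l = 0" if "l \<notin> j ` {1..p}" for l
    using that x by (subst (asm) sum_nonneg_eq_0_iff) (auto simp: strategy_set_def)
  have "x = (\<Sum>i = 1..p. (x $ j i) *\<^sub>R axis (j i) 1)"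
    by (simp only: vec_eq_iff sum_axis_nth[OF inj]) (simp add: zero)
  then show ?thesis
    using sum1 pos unfolding face_interior_def by blast
qed

theorem corollary2:
  fixes k p :: nat
    and c :: "nat \<Rightarrow> real ^ 'n"
    and j :: "nat \<Rightarrow> 'n"
    and x0 :: "real ^ 'n"
  assumes "k \<ge> 2"
    and "CARD('n) \<ge> 2"
    and "p \<in> {2..CARD('n) - 1}"
    and "x0 \<in> strategy_set"
    and "partially_randomized p j x0"
  shows "x0 \<in> efficient_set k c \<longleftrightarrow> face_interior p j \<subseteq> efficient_set k c"
proof
  assume x0_eff: "x0 \<in> efficient_set k c"
  have inj: "inj_on j {1..p}" and pos: "\<And>i. i \<in> {1..p} \<Longrightarrow> x0 $ j i > 0"
    using assms(5) by (auto simp: partially_randomized_def)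
  show "face_interior p j \<subseteq> efficient_set k c"
  proof
    fix y assume y: "y \<in> face_interior p j"
    note face = face_interior_in_strategy_set[OF inj y]
    have "y $ l = 0" if "x0 $ l = 0" for l
    proof (rule face(2))
      show "l \<notin> j ` {1..p}"
        using that pos by force
    qed
    then show "y \<in> efficient_set k c"
      by (rule efficient_support_mono[OF x0_eff face(1)])
  qed
next
  assume "face_interior p j \<subseteq> efficient_set k c"
  then show "x0 \<in> efficient_set k c"
    using partially_randomized_in_face_interior[OF assms(5)] by blast
qed

end
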